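(* Let $S$ be a subfit and round $\vee$-semilattice. Then $\mathrm{cl}(\widehat{S}_p)$, the closure of $\widehat{S}_p$ in the spectrum $\widehat{S}$, is compact for all $p\in S$.
   Context: A $\vee$-semilattice is a non-empty poset in which any two elements $p,q$ have a supremum $p\vee q$. A grill in a $\vee$-semilattice $S$ is a subset $G\subseteq S$ such that $p\vee q\geq g\in G$ implies $p\in G$ or $q\in G$. The spectrum $\widehat{S}$ is the set of all proper minimal non-empty grills of $S$, i.e. grills $G$ with $\emptyset\neq G\neq S$ such that no non-empty grill is strictly contained in $G$. It carries the topology generated by the subbasis $(\widehat{S}_p)_{p\in S}$, where $\widehat{S}_p=\{G\in\widehat{S}:p\in G\}$. Compact means every open cover has a finite subcover (no Hausdorff assumption). A non-empty finite $F\subseteq S$ is far if for all $p,q\in S$: if $p\leq q\vee f$ for all $f\in F$, then $p\leq q$. The rather below relation is defined by: $p\prec q$ iff for all $s\in S$ with $s\nleq q$ there is a finite $F\subseteq S$ such that $F\cup\{p\}$ is far and $s\leq f\vee q$ for all $f\in F$. $S$ is round if for every $p\in S$ there is $q\in S$ with $p\prec q$. $S$ is subfit if for all $p,q\in S$: $p\nleq q$ iff for every $p'\geq p$ there is $q'\geq q$ with $p\vee q'\geq p'$ and $p'\nleq q'$. *)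

theory Defs
  imports "HOL-Analysis.Analysis"
begin

text \<open>
  A join-semilattice $S$ is modelled as a type \<open>'a :: semilattice_sup\<close>, so the whole of $S$ is
  \<open>UNIV\<close> (non-empty, as every type is). No bottom or top element is assumed.
\<close>

definition grill :: "'a::semilattice_sup set \<Rightarrow> bool" where
  "grill G \<longleftrightarrow> (\<forall>p q. \<forall>g\<in>G. g \<le> sup p q \<longrightarrow> p \<in> G \<or> q \<in> G)"

text \<open>The empty set is a grill, so minimality is only demanded among non-empty grills.\<close>

definition spectrum :: "'a::semilattice_sup set set" where
  "spectrum = {G. grill G \<and> G \<noteq> {} \<and> G \<noteq> UNIV \<and> \<not> (\<exists>H. grill H \<and> H \<noteq> {} \<and> H \<subset> G)}"

definition spectrum_at :: "'a::semilattice_sup \<Rightarrow> 'a set set" where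
  "spectrum_at p = {G \<in> spectrum. p \<in> G}"

definition spectrum_topology :: "'a::semilattice_sup set topology" where
  "spectrum_topology = topology_generated_by (range spectrum_at)"

text \<open>
  The subbasis covers the spectrum because its points are non-empty, so the convention used for
  the empty intersection of subbasic sets does not matter.
\<close>

lemma topspace_spectrum_topology: "topspace spectrum_topology = spectrum"
  by (auto simp: spectrum_topology_def spectrum_at_def spectrum_def)

definition far :: "'a::semilattice_sup set \<Rightarrow> bool" where
  "far F \<longleftrightarrow> finite F \<and> F \<noteq> {} \<and> (\<forall>p q. (\<forall>f\<in>F. p \<le> sup q f) \<longrightarrow> p \<le> q)"

text \<open>The set \<open>F\<close> below may be empty.\<close>

definition rather_below :: "'a::semilattice_sup \<Rightarrow> 'a \<Rightarrow> bool" where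
  "rather_below p q \<longleftrightarrow>
     (\<forall>s. \<not> s \<le> q \<longrightarrow> (\<exists>F. finite F \<and> far (F \<union> {p}) \<and> (\<forall>f\<in>F. s \<le> sup f q)))"

definition round_semilattice :: "'a::semilattice_sup itself \<Rightarrow> bool" where
  "round_semilattice _ \<longleftrightarrow> (\<forall>p::'a. \<exists>q. rather_below p q)"

definition subfit_semilattice :: "'a::semilattice_sup itself \<Rightarrow> bool" where
  "subfit_semilattice _ \<longleftrightarrow>
     (\<forall>p q::'a. \<not> p \<le> q \<longleftrightarrow> (\<forall>p'\<ge>p. \<exists>q'\<ge>q. sup p q' \<ge> p' \<and> \<not> p' \<le> q'))"

end

theory Submission
  imports Defs
begin

text \<open>
  Points of the spectrum are complements of maximal proper ideals. Such an ideal meets \<open>F\<close>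
  whenever \<open>F\<close> is far, and by subfitness and roundness the closure of the set of points
  containing \<open>p\<close> consists of those whose ideal meets every \<open>F\<close> with \<open>F \<union> {p}\<close> far. If \<open>p\<close> is
  rather below \<open>q\<close>, then every ideal meeting all these \<open>F\<close> generates the whole semilattice
  together with \<open>q\<close>, so once it omits \<open>q\<close>, any extension maximal among ideals omitting \<open>q\<close> is
  already maximal proper. By Alexander's subbase theorem it is enough to find, for a subbasic
  family without a finite subcover, a point of the closure whose ideal contains all its indices;
  a Zorn-type limit of the ideals witnessing the failure of finite subcovers, extended in this
  way, is such an ideal.
\<close>

section \<open>Ideals and their extensions\<close>

text \<open>The equivalence packs closure under joins and downward closure together. Both
  \<open>{}\<close> and \<open>UNIV\<close> qualify, so nonemptiness and properness appear as
  separate conditions.\<close>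

definition ideal :: "'a::semilattice_sup set \<Rightarrow> bool" where
  "ideal I \<longleftrightarrow> (\<forall>x y. sup x y \<in> I \<longleftrightarrow> x \<in> I \<and> y \<in> I)"

lemma ideal_sup_iff: "ideal I \<Longrightarrow> sup x y \<in> I \<longleftrightarrow> x \<in> I \<and> y \<in> I"
  by (simp add: ideal_def)

lemma ideal_downward: "ideal I \<Longrightarrow> y \<in> I \<Longrightarrow> x \<le> y \<Longrightarrow> x \<in> I"
  by (metis ideal_sup_iff sup.absorb2)

lemma idealI:
  assumes "\<And>x y. y \<in> I \<Longrightarrow> x \<le> y \<Longrightarrow> x \<in> I" "\<And>x y. x \<in> I \<Longrightarrow> y \<in> I \<Longrightarrow> sup x y \<in> I"
  shows "ideal I"
  unfolding ideal_def by (meson assms sup_ge1 sup_ge2)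

lemma grill_iff_ideal: "grill G \<longleftrightarrow> ideal (- G)"
proof
  assume G: "grill G"
  \<comment> \<open>Downward closure is the grill condition with both joined elements equal.\<close>
  show "ideal (- G)"
    using G unfolding grill_def by (intro idealI) (simp_all, metis sup.idem, blast)
next
  assume I: "ideal (- G)"
  show "grill G"
    unfolding grill_def
  proof (intro allI ballI impI)
    fix p q g assume "g \<in> G" "g \<le> sup p q"
    then show "p \<in> G \<or> q \<in> G"
      using ideal_sup_iff[OF I, of p q] ideal_downward[OF I, of "sup p q" g] by blast
  qed
qed

lemma ideal_finite_bound:
  assumes "ideal I" "I \<noteq> {}" "finite F" "F \<subseteq> I"
  shows "\<exists>i\<in>I. \<forall>f\<in>F. f \<le> i"
  using assms(3,4)
proof (induction F rule: finite_induct)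
  case empty
  then show ?case using assms(2) by auto
next
  case (insert f F)
  then obtain i where "i \<in> I" "\<forall>f\<in>F. f \<le> i" by auto
  with insert.prems show ?case
    using ideal_sup_iff[OF assms(1)] by (intro bexI[of _ "sup f i"]) (auto intro: le_supI2)
qed

text \<open>Farness can only be applied with one common \<open>q\<close> for all members of the far
  set; directedness of \<open>I\<close> merges the individual witnesses into one.\<close>

lemma ideal_directed_witnesses:
  assumes I: "ideal I" "I \<noteq> {}" and F: "finite F" "\<And>f. f \<in> F \<Longrightarrow> \<exists>i\<in>I. t \<le> sup f i"
  shows "\<exists>i\<in>I. \<forall>f\<in>F. t \<le> sup f i"
proof -
  obtain i where i: "\<And>f. f \<in> F \<Longrightarrow> i f \<in> I \<and> t \<le> sup f (i f)"
    using F(2) by metis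
  then obtain j where "j \<in> I" "\<forall>f\<in>F. i f \<le> j"
    using ideal_finite_bound[OF I, of "i ` F"] F(1) by auto
  then show ?thesis
    using i by (meson order.refl order.trans sup.mono)
qed

lemma ideal_adjoin:
  assumes "ideal I"
  shows "ideal {y. \<exists>i\<in>I. y \<le> sup x i}"
proof (rule idealI)
  fix y z
  assume "y \<in> {y. \<exists>i\<in>I. y \<le> sup x i}" "z \<in> {y. \<exists>i\<in>I. y \<le> sup x i}"
  then obtain i j where "i \<in> I" "j \<in> I" "y \<le> sup x i" "z \<le> sup x j" by auto
  moreover from this have "sup y z \<le> sup x (sup i j)"
    by (intro sup_least; elim order.trans) (auto intro: le_supI1 le_supI2)
  ultimately show "sup y z \<in> {y. \<exists>i\<in>I. y \<le> sup x i}"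
    using ideal_sup_iff[OF assms] by blast
qed (auto intro: order.trans)

text \<open>Zorn's lemma on the ideals above \<open>I\<close> that omit \<open>q\<close>. Maximality
  is recorded in the form used later: the ideal generated by \<open>M\<close> and any further
  \<open>x\<close> captures \<open>q\<close>.\<close>

lemma ideal_extend_maximal_avoiding:
  assumes "ideal I" "I \<noteq> {}" "q \<notin> I"
  obtains M where "I \<subseteq> M" "ideal M" "q \<notin> M" "\<And>x. x \<notin> M \<Longrightarrow> \<exists>i\<in>M. q \<le> sup x i"
proof -
  define \<A> where "\<A> = {J. ideal J \<and> I \<subseteq> J \<and> q \<notin> J}"
  have "\<exists>M\<in>\<A>. \<forall>X\<in>\<A>. M \<subseteq> X \<longrightarrow> X = M"
  proof (rule subset_Zorn_nonempty)
    show "\<A> \<noteq> {}" using assms by (auto simp: \<A>_def)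
  next
    fix \<C> assume C: "\<C> \<noteq> {}" "subset.chain \<A> \<C>"
    then have A: "\<And>J. J \<in> \<C> \<Longrightarrow> ideal J \<and> I \<subseteq> J \<and> q \<notin> J"
      by (auto simp: \<A>_def subset_chain_def)
    have "ideal (\<Union>\<C>)"
    proof (rule idealI)
      fix x y assume "x \<in> \<Union>\<C>" "y \<in> \<Union>\<C>"
      then obtain J J' where J: "J \<in> \<C>" "x \<in> J" "J' \<in> \<C>" "y \<in> J'" by blast
      moreover have "J \<subseteq> J' \<or> J' \<subseteq> J"
        using C(2) J by (auto simp: subset_chain_def)
      ultimately obtain K where "K \<in> \<C>" "x \<in> K" "y \<in> K" by blast
      then show "sup x y \<in> \<Union>\<C>"
        using A ideal_sup_iff[of K x y] by blast
    next
      fix x y assume "y \<in> \<Union>\<C>" "x \<le> y"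
      then show "x \<in> \<Union>\<C>"
        using A ideal_downward by (meson UnionE UnionI)
    qed
    then show "\<Union>\<C> \<in> \<A>" using A C(1) by (auto simp: \<A>_def)
  qed
  then obtain M where M: "ideal M" "I \<subseteq> M" "q \<notin> M" and
    max: "\<And>X. ideal X \<Longrightarrow> I \<subseteq> X \<Longrightarrow> q \<notin> X \<Longrightarrow> M \<subseteq> X \<Longrightarrow> X = M"
    by (auto simp: \<A>_def)
  have absorb: "\<exists>i\<in>M. q \<le> sup x i" if "x \<notin> M" for x
  proof (rule ccontr)
    let ?J = "{y. \<exists>i\<in>M. y \<le> sup x i}"
    assume "\<not> (\<exists>i\<in>M. q \<le> sup x i)"
    then have "q \<notin> ?J" by simp
    moreover have "M \<subseteq> ?J" by (auto intro: le_supI2)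
    moreover have "ideal ?J" using M(1) by (rule ideal_adjoin)
    ultimately have "?J = M" using max M(2) by (meson order.trans)
    moreover have "x \<in> ?J" using M(2) assms(2) by auto
    ultimately show False using that by simp
  qed
  show thesis by (rule that[OF M(2,1,3) absorb])
qed

section \<open>Points of the spectrum as complements of ideals\<close>

lemma spectrum_ideal:
  assumes "G \<in> spectrum"
  shows "ideal (- G)" "- G \<noteq> {}" "G \<noteq> {}"
  using assms by (auto simp: spectrum_def grill_iff_ideal)

text \<open>Otherwise the ideal generated by \<open>x\<close> and \<open>- G\<close> omits
  \<open>t\<close>, and its complement is a nonempty grill strictly inside \<open>G\<close>, against
  minimality.\<close>

lemma spectrum_absorbs:
  assumes G: "G \<in> spectrum" and x: "x \<in> G"
  shows "\<exists>i\<in>- G. t \<le> sup x i"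
proof (rule ccontr)
  let ?J = "{y. \<exists>i\<in>- G. y \<le> sup x i}"
  assume "\<not> (\<exists>i\<in>- G. t \<le> sup x i)"
  then have "- ?J \<noteq> {}" by blast
  moreover have "grill (- ?J)"
    using ideal_adjoin spectrum_ideal(1)[OF G] by (simp only: grill_iff_ideal double_complement)
  moreover have "- ?J \<subset> G"
  proof -
    have "y \<in> ?J" if "y \<notin> G" for y using that by (auto intro: le_supI2)
    moreover have "x \<in> ?J" using spectrum_ideal(2)[OF G] by auto
    ultimately show ?thesis using x by blast
  qed
  ultimately show False using G unfolding spectrum_def by blast
qed

text \<open>Here \<open>q\<close> is a relay: an ideal containing \<open>M\<close> and some
  \<open>x\<close> outside \<open>M\<close> captures \<open>q\<close> by the first absorption
  property and then every \<open>t\<close> by the second.\<close>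

lemma in_spectrumI:
  assumes M: "ideal M" "M \<noteq> {}" "q \<notin> M"
    and absorb: "\<And>x. x \<notin> M \<Longrightarrow> \<exists>i\<in>M. q \<le> sup x i" "\<And>t. \<exists>i\<in>M. t \<le> sup q i"
  shows "- M \<in> spectrum"
proof -
  have "H = - M" if "grill H" "H \<noteq> {}" "H \<subseteq> - M" for H
  proof -
    have H: "ideal (- H)" using that by (simp add: grill_iff_ideal)
    have "x \<in> H" if x: "x \<notin> M" for x
    proof (rule ccontr)
      assume "x \<notin> H"
      have "t \<in> - H" for t
      proof -
        obtain i where i: "i \<in> M" "q \<le> sup x i" using absorb(1)[OF x] by blast
        obtain j where j: "j \<in> M" "t \<le> sup q j" using absorb(2) by blast
        have "i \<in> - H" "j \<in> - H" using \<open>H \<subseteq> - M\<close> i(1) j(1) by auto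
        then have "sup x i \<in> - H" using \<open>x \<notin> H\<close> ideal_sup_iff[OF H, of x i] by blast
        then have "q \<in> - H" using i(2) by (rule ideal_downward[OF H])
        then have "sup q j \<in> - H" using \<open>j \<in> - H\<close> ideal_sup_iff[OF H, of q j] by blast
        then show ?thesis using j(2) by (rule ideal_downward[OF H])
      qed
      with \<open>H \<noteq> {}\<close> show False by blast
    qed
    with that show ?thesis by blast
  qed
  then show ?thesis
    using M by (auto simp: spectrum_def grill_iff_ideal)
qed

section \<open>Far sets and the rather below relation\<close>

text \<open>If \<open>F\<close> lay in \<open>G\<close>, some \<open>i\<close> outside
  \<open>G\<close> would satisfy \<open>g \<le> sup f i\<close> for all \<open>f\<close> in
  \<open>F\<close> and a fixed \<open>g\<close> in \<open>G\<close>; farness then puts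
  \<open>g\<close> below \<open>i\<close>, hence outside \<open>G\<close>.\<close>

lemma far_avoids_spectrum:
  assumes "far F" "G \<in> spectrum"
  shows "\<not> F \<subseteq> G"
proof
  assume "F \<subseteq> G"
  obtain g where g: "g \<in> G" using spectrum_ideal(3)[OF assms(2)] by blast
  have "finite F" using assms(1) by (simp add: far_def)
  moreover have "\<exists>i\<in>- G. g \<le> sup f i" if "f \<in> F" for f
    using spectrum_absorbs[OF assms(2)] \<open>F \<subseteq> G\<close> that by blast
  ultimately obtain i where "i \<in> - G" "\<forall>f\<in>F. g \<le> sup f i"
    using ideal_directed_witnesses[OF spectrum_ideal(1,2)[OF assms(2)], of F g] by blast
  then have "g \<le> i" using assms(1) unfolding far_def by (metis sup_commute)
  then show False
    using ideal_downward[OF spectrum_ideal(1)[OF assms(2)] \<open>i \<in> - G\<close>] g by blast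
qed

text \<open>The argument of \<open>far_avoids_spectrum\<close> with \<open>p\<close> in the role of
  \<open>g\<close>: maximality among ideals omitting \<open>p\<close> suffices because the element
  to dominate is \<open>p\<close> itself.\<close>

lemma far_meets_maximal_avoiding:
  assumes M: "ideal M" "M \<noteq> {}" "p \<notin> M" "\<And>x. x \<notin> M \<Longrightarrow> \<exists>i\<in>M. p \<le> sup x i"
    and F: "far (F \<union> {p})"
  shows "F \<inter> M \<noteq> {}"
proof
  assume "F \<inter> M = {}"
  then obtain i where "i \<in> M" "\<forall>f\<in>F \<union> {p}. p \<le> sup f i"
    using ideal_directed_witnesses[OF M(1,2), of "F \<union> {p}" p] M(3,4) F
    unfolding far_def by (metis UnE disjoint_iff singletonD)
  then have "p \<le> i" using F unfolding far_def by (metis sup_commute)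
  then show False using M \<open>i \<in> M\<close> ideal_downward by blast
qed

text \<open>For \<open>t\<close> not below \<open>q\<close>, the definition of
  \<open>rather_below\<close> supplies an \<open>F\<close>, and any element of \<open>F\<close> in
  \<open>I\<close> serves as \<open>i\<close>.\<close>

lemma rather_below_absorbs:
  assumes "rather_below p q" "I \<noteq> {}"
    and meets: "\<And>F. far (F \<union> {p}) \<Longrightarrow> F \<inter> I \<noteq> {}"
  shows "\<exists>i\<in>I. t \<le> sup q i"
proof (cases "t \<le> q")
  case True
  then show ?thesis using assms(2) le_supI1 by blast
next
  case False
  then show ?thesis
    using assms(1) meets unfolding rather_below_def by (metis disjoint_iff sup_commute)
qed

lemma rather_below_le:
  assumes "rather_below p q"
  shows "p \<le> q"
proof (rule ccontr)
  assume "\<not> p \<le> q"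
  \<comment> \<open>The definition is applied with \<open>s = p\<close>; the member \<open>p\<close>
    of the far set dominates \<open>p\<close> trivially.\<close>
  then obtain F where "far (F \<union> {p})" "\<forall>f\<in>F. p \<le> sup f q"
    using assms unfolding rather_below_def by blast
  then have "p \<le> q" unfolding far_def by (metis UnE singletonD sup_commute sup_ge1)
  with \<open>\<not> p \<le> q\<close> show False by simp
qed

lemma spectrum_above_ideal:
  assumes pq: "rather_below p q" and I: "ideal I" "I \<noteq> {}" "q \<notin> I"
    and meets: "\<And>F. far (F \<union> {p}) \<Longrightarrow> F \<inter> I \<noteq> {}"
  shows "\<exists>G\<in>spectrum. q \<in> G \<and> G \<inter> I = {}"
proof -
  obtain M where M: "I \<subseteq> M" "ideal M" "q \<notin> M" "\<And>x. x \<notin> M \<Longrightarrow> \<exists>i\<in>M. q \<le> sup x i"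
    using ideal_extend_maximal_avoiding[OF I] by metis
  then have "- M \<in> spectrum"
    using I(2) rather_below_absorbs[OF pq I(2) meets]
    by (intro in_spectrumI[of M q]) blast+
  with M show ?thesis by (intro bexI[of _ "- M"]) auto
qed

text \<open>Converse of \<open>far_avoids_spectrum\<close>. If \<open>u\<close> and \<open>v\<close>
  refute farness, any point containing \<open>u\<close> but not \<open>v\<close> contains
  \<open>F\<close>; roundness and subfitness provide such a point.\<close>

lemma not_far_spectrum:
  assumes "subfit_semilattice TYPE('a)" "round_semilattice TYPE('a)"
    and F: "finite F" "F \<noteq> {}" "\<not> far (F :: 'a::semilattice_sup set)"
  shows "\<exists>G\<in>spectrum. F \<subseteq> G"
proof -
  obtain u v where uv: "\<not> u \<le> v" "\<forall>f\<in>F. u \<le> sup v f"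
    using F unfolding far_def by blast
  obtain u' where u': "rather_below u u'"
    using assms(2) unfolding round_semilattice_def by blast
  obtain v' where v': "v' \<ge> v" "sup u v' \<ge> u'" "\<not> u' \<le> v'"
    using assms(1) uv(1) rather_below_le[OF u'] unfolding subfit_semilattice_def by meson
  have "ideal {..v'}" by (auto intro: idealI)
  \<comment> \<open>If \<open>u \<le> v'\<close>, then \<open>sup u v' = v'\<close> would lie above
    \<open>u'\<close>.\<close>
  moreover have "u \<notin> {..v'}"
    using v' by (auto simp: sup_absorb2)
  ultimately obtain I where I: "{..v'} \<subseteq> I" "ideal I" "u \<notin> I"
    and max: "\<And>x. x \<notin> I \<Longrightarrow> \<exists>i\<in>I. u \<le> sup x i"
    using ideal_extend_maximal_avoiding[of "{..v'}" u] by blast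
  have "I \<noteq> {}" using I(1) by auto
  have "u' \<notin> I"
    using I(2,3) rather_below_le[OF u'] ideal_downward by blast
  moreover have "F \<inter> I \<noteq> {}" if "far (F \<union> {u})" for F
    by (rule far_meets_maximal_avoiding[OF I(2) \<open>I \<noteq> {}\<close> I(3) max that])
  ultimately obtain G where G: "G \<in> spectrum" "u' \<in> G" "G \<inter> I = {}"
    using spectrum_above_ideal[OF u' I(2) \<open>I \<noteq> {}\<close>] by metis
  have id: "ideal (- G)" using G(1) by (rule spectrum_ideal)
  have v'G: "v' \<in> - G" using I(1) G(3) by auto
  then have "v \<in> - G" using v'(1) ideal_downward[OF id] by blast
  \<comment> \<open>The extension of \<open>I\<close> keeps only \<open>u'\<close> out of the ideal.
    Since it contains \<open>v'\<close> and \<open>u' \<le> sup u v'\<close>, it cannot have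
    swallowed \<open>u\<close>.\<close>
  moreover have "u \<notin> - G"
    using G(2) v'G v'(2) ideal_sup_iff[OF id] ideal_downward[OF id] by blast
  ultimately have "F \<subseteq> G"
    using uv(2) ideal_sup_iff[OF id] ideal_downward[OF id] by blast
  with G(1) show ?thesis by blast
qed

section \<open>The closure of a subbasic set\<close>

lemma openin_spectrum_basic:
  assumes "openin spectrum_topology U" "G \<in> U"
  obtains F where "finite F" "F \<subseteq> G" "\<And>H. H \<in> spectrum \<Longrightarrow> F \<subseteq> H \<Longrightarrow> H \<in> U"
proof -
  have "generate_topology_on (range spectrum_at) U"
    using assms(1) by (simp add: spectrum_topology_def openin_topology_generated_by_iff)
  then have "\<exists>F. finite F \<and> F \<subseteq> G \<and> (\<forall>H\<in>spectrum. F \<subseteq> H \<longrightarrow> H \<in> U)"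
    using assms(2)
  proof induction
    case (Int a b)
    then obtain F F' where "finite F" "F \<subseteq> G" "\<forall>H\<in>spectrum. F \<subseteq> H \<longrightarrow> H \<in> a"
      "finite F'" "F' \<subseteq> G" "\<forall>H\<in>spectrum. F' \<subseteq> H \<longrightarrow> H \<in> b" by blast
    then show ?case by (intro exI[of _ "F \<union> F'"]) auto
  next
    case (UN K)
    then obtain k where k: "k \<in> K" "G \<in> k" by blast
    then show ?case using UN.IH[OF k] by (meson UnionI)
  next
    case (Basis s)
    then obtain x where "s = spectrum_at x" by blast
    with Basis(2) show ?case
      by (intro exI[of _ "{x}"]) (auto simp: spectrum_at_def)
  qed simp
  then show thesis by (auto intro: that)
qed

lemma openin_spectrum_finite_Inter:
  assumes "finite F"
  shows "openin spectrum_topology {G \<in> spectrum. F \<subseteq> G}"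
  using assms
proof (induction F rule: finite_induct)
  case empty
  then show ?case
    by (metis (no_types, lifting) Collect_mem_eq Collect_cong empty_subsetI openin_topspace
        topspace_spectrum_topology)
next
  case (insert x F)
  have "openin spectrum_topology (spectrum_at x)"
    unfolding spectrum_topology_def by (rule topology_generated_by_Basis) simp
  moreover have "{G \<in> spectrum. insert x F \<subseteq> G} = spectrum_at x \<inter> {G \<in> spectrum. F \<subseteq> G}"
    by (auto simp: spectrum_at_def)
  ultimately show ?case using insert.IH by (simp add: openin_Int)
qed

text \<open>Basic neighbourhoods of \<open>G\<close> come from finite
  \<open>F \<subseteq> G\<close>. Such a neighbourhood meets \<open>spectrum_at p\<close> iff some
  point contains \<open>F \<union> {p}\<close>, that is, iff this set is not far.\<close>

lemma closure_of_spectrum_at: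
  assumes "subfit_semilattice TYPE('a)" "round_semilattice TYPE('a)"
  shows "spectrum_topology closure_of (spectrum_at (p :: 'a::semilattice_sup)) =
    {G \<in> spectrum. \<forall>F. far (F \<union> {p}) \<longrightarrow> \<not> F \<subseteq> G}" (is "?L = ?R")
proof (intro equalityI subsetI)
  fix G assume G: "G \<in> ?L"
  then have "G \<in> spectrum"
    by (metis in_closure_of topspace_spectrum_topology)
  moreover have "\<not> F \<subseteq> G" if F: "far (F \<union> {p})" for F
  proof
    assume "F \<subseteq> G"
    moreover have "finite F" using F by (simp add: far_def)
    ultimately obtain H where "H \<in> spectrum_at p" "H \<in> {G \<in> spectrum. F \<subseteq> G}"
      using G openin_spectrum_finite_Inter \<open>G \<in> spectrum\<close>
      by (metis (mono_tags, lifting) in_closure_of mem_Collect_eq)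
    then show False
      using far_avoids_spectrum[OF F] by (auto simp: spectrum_at_def)
  qed
  ultimately show "G \<in> ?R" by blast
next
  fix G assume G: "G \<in> ?R"
  have "\<exists>H. H \<in> spectrum_at p \<and> H \<in> U" if "openin spectrum_topology U" "G \<in> U" for U
  proof -
    obtain F where F: "finite F" "F \<subseteq> G" "\<And>H. H \<in> spectrum \<Longrightarrow> F \<subseteq> H \<Longrightarrow> H \<in> U"
      using openin_spectrum_basic \<open>openin _ U\<close> \<open>G \<in> U\<close> by metis
    then obtain H where "H \<in> spectrum" "F \<union> {p} \<subseteq> H"
      using not_far_spectrum[OF assms, of "F \<union> {p}"] G by auto
    with F show ?thesis by (auto simp: spectrum_at_def)
  qed
  then show "G \<in> ?L"
    using G by (auto simp: in_closure_of topspace_spectrum_topology)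
qed

text \<open>Puts the closure of \<open>spectrum_at p\<close> inside \<open>spectrum_at q\<close>:
  were \<open>q\<close> in the ideal \<open>- G\<close>, absorption would make that ideal
  everything.\<close>

lemma rather_below_closure:
  assumes "rather_below p q" "G \<in> spectrum" "\<And>F. far (F \<union> {p}) \<Longrightarrow> \<not> F \<subseteq> G"
  shows "q \<in> G"
proof (rule ccontr)
  assume "q \<notin> G"
  have id: "ideal (- G)" using assms(2) by (rule spectrum_ideal)
  obtain t where "t \<in> G" using spectrum_ideal(3)[OF assms(2)] by blast
  have "F \<inter> - G \<noteq> {}" if "far (F \<union> {p})" for F
    using assms(3)[OF that] by blast
  then obtain i where i: "i \<in> - G" "t \<le> sup q i"
    using rather_below_absorbs[OF assms(1) spectrum_ideal(2)[OF assms(2)]] by metis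
  then have "sup q i \<in> - G"
    using \<open>q \<notin> G\<close> ideal_sup_iff[OF id, of q i] by blast
  then show False
    using \<open>t \<in> G\<close> ideal_downward[OF id _ i(2)] by blast
qed

section \<open>Compactness from a subbase\<close>

text \<open>Alexander's theorem makes \<open>K\<close> compact in the topology \<open>X\<close>
  generated by the traces of the subbase on \<open>K\<close>; the identity carries this into the
  ambient topology.\<close>

lemma compactin_topology_generated_by:
  assumes "K \<subseteq> \<Union>\<B>"
    and fin: "\<And>C. C \<subseteq> \<B> \<Longrightarrow> K \<subseteq> \<Union>C \<Longrightarrow> \<exists>C'. finite C' \<and> C' \<subseteq> C \<and> K \<subseteq> \<Union>C'"
  shows "compactin (topology_generated_by \<B>) K"
proof -
  define X where "X = topology (arbitrary union_of
    (finite intersection_of (\<lambda>x. x \<in> \<B>) relative_to K))"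
  have top: "topspace X = K" by (simp add: X_def topspace_subbase)
  have "compact_space X"
    by (rule Alexander_subbase_alt[OF assms]) (simp_all add: X_def)
  moreover have "openin X (U \<inter> K)" if "U \<in> \<B>" for U
    using that unfolding X_def openin_subbase
    by (metis arbitrary_union_of_inc finite_intersection_of_inc inf_commute relative_to_inc)
  then have "continuous_map X (topology_generated_by \<B>) id"
    using assms(1) by (intro continuous_on_generated_topo) (auto simp: top)
  ultimately show ?thesis
    using image_compactin[of X K "topology_generated_by \<B>" id] top
    by (simp add: compact_space_def)
qed

text \<open>A set that is maximal among those whose finite subsets are all missed by some grill
  in \<open>K\<close> plays the role of an ultrafilter limit of the complements of these grills.\<close>

lemma maximal_finitely_missed:
  assumes K: "\<And>G. G \<in> K \<Longrightarrow> ideal (- G) \<and> - G \<noteq> {}"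
    and A: "\<And>F. finite F \<Longrightarrow> F \<subseteq> A \<Longrightarrow> \<exists>G\<in>K. F \<inter> G = {}"
  obtains B where "A \<subseteq> B" "ideal B" "B \<noteq> {}"
    "\<And>x. x \<in> B \<Longrightarrow> \<exists>G\<in>K. x \<notin> G"
    "\<And>F. finite F \<Longrightarrow> (\<And>G. G \<in> K \<Longrightarrow> \<not> F \<subseteq> G) \<Longrightarrow> F \<inter> B \<noteq> {}"
proof -
  define P where "P B \<longleftrightarrow> (\<forall>F. finite F \<longrightarrow> F \<subseteq> B \<longrightarrow> (\<exists>G\<in>K. F \<inter> G = {}))" for B
  have "\<exists>M\<in>{B. A \<subseteq> B \<and> P B}. \<forall>X\<in>{B. A \<subseteq> B \<and> P B}. M \<subseteq> X \<longrightarrow> X = M"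
  proof (rule subset_Zorn_nonempty)
    show "{B. A \<subseteq> B \<and> P B} \<noteq> {}" using A by (auto simp: P_def)
  next
    fix \<C> assume C: "\<C> \<noteq> {}" "subset.chain {B. A \<subseteq> B \<and> P B} \<C>"
    have "P (\<Union>\<C>)"
      unfolding P_def
    proof (intro allI impI)
      fix F assume "finite F" "F \<subseteq> \<Union>\<C>"
      then obtain B where "B \<in> \<C>" "F \<subseteq> B"
        using finite_subset_Union_chain[OF _ _ C] by blast
      then show "\<exists>G\<in>K. F \<inter> G = {}"
        using C(2) \<open>finite F\<close> by (auto simp: P_def subset_chain_def)
    qed
    moreover have "A \<subseteq> \<Union>\<C>"
      using C unfolding subset_chain_def by blast
    ultimately show "\<Union>\<C> \<in> {B. A \<subseteq> B \<and> P B}" by blast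
  qed
  then obtain B where B: "A \<subseteq> B" "P B" and
    B_max: "\<And>X. A \<subseteq> X \<Longrightarrow> P X \<Longrightarrow> B \<subseteq> X \<Longrightarrow> X = B"
    by auto
  have max: "X = B" if "B \<subseteq> X" "P X" for X
    using B_max that B(1) by (meson order.trans)
  \<comment> \<open>By maximality some finite \<open>F \<subseteq> insert x B\<close> is met by
    every grill in \<open>K\<close>; a grill missing \<open>F - {x}\<close> must then contain
    \<open>x\<close>.\<close>
  have witness: "\<exists>F. finite F \<and> F \<subseteq> B \<and> (\<forall>G\<in>K. F \<inter> G = {} \<longrightarrow> x \<in> G)" if x: "x \<notin> B" for x
  proof -
    have "\<not> P (insert x B)" using max[of "insert x B"] x by blast
    then obtain F where F: "finite F" "F \<subseteq> insert x B" "\<forall>G\<in>K. F \<inter> G \<noteq> {}"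
      by (auto simp: P_def)
    then show ?thesis by (intro exI[of _ "F - {x}"]) auto
  qed
  \<comment> \<open>\<open>B\<close> contains whatever finitely many of its members force to be
    missed; this yields both ideal laws.\<close>
  have closed: "x \<in> B" if F: "finite F" "F \<subseteq> B" "\<And>G. G \<in> K \<Longrightarrow> F \<inter> G = {} \<Longrightarrow> x \<notin> G" for F x
  proof (rule ccontr)
    assume "x \<notin> B"
    then obtain F' where F': "finite F'" "F' \<subseteq> B" "\<forall>G\<in>K. F' \<inter> G = {} \<longrightarrow> x \<in> G"
      using witness[of x] by blast
    then obtain G where "G \<in> K" "(F \<union> F') \<inter> G = {}"
      using B(2) F(1,2) unfolding P_def by (metis Un_subset_iff finite_UnI)
    with F' F(3) show False by blast
  qed
  have meets: "F \<inter> B \<noteq> {}" if F: "finite F" "\<And>G. G \<in> K \<Longrightarrow> \<not> F \<subseteq> G" for F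
  proof
    assume disj: "F \<inter> B = {}"
    have "\<forall>x\<in>F. \<exists>W. finite W \<and> W \<subseteq> B \<and> (\<forall>G\<in>K. W \<inter> G = {} \<longrightarrow> x \<in> G)"
      using disj by (intro ballI witness) blast
    then obtain W where W: "\<And>x. x \<in> F \<Longrightarrow>
        finite (W x) \<and> W x \<subseteq> B \<and> (\<forall>G\<in>K. W x \<inter> G = {} \<longrightarrow> x \<in> G)"
      by (metis (no_types, lifting) bchoice)
    then have "finite (\<Union>(W ` F))" "\<Union>(W ` F) \<subseteq> B" using F(1) by auto
    \<comment> \<open>One grill missing all the witness sets contains every element of
      \<open>F\<close>.\<close>
    then obtain G where G: "G \<in> K" "\<Union>(W ` F) \<inter> G = {}"
      using B(2) unfolding P_def by blast
    then have "F \<subseteq> G" using W by blast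
    with F(2) G(1) show False by blast
  qed
  have "ideal B"
  proof (rule idealI)
    fix x y assume "y \<in> B" "x \<le> y"
    then show "x \<in> B"
      using K ideal_downward by (intro closed[of "{y}"]) blast+
  next
    fix x y assume "x \<in> B" "y \<in> B"
    then show "sup x y \<in> B"
      using K ideal_sup_iff by (intro closed[of "{x, y}"]) blast+
  qed
  moreover have "\<exists>G\<in>K. x \<notin> G" if "x \<in> B" for x
    using B(2) that unfolding P_def by (auto dest: spec[of _ "{x}"])
  moreover have "B \<noteq> {}"
  proof
    assume "B = {}"
    obtain G where G: "G \<in> K" using A[of "{}"] by auto
    then obtain x where "x \<notin> G" using K by blast
    then have "P {x}" using G unfolding P_def by blast
    with max[of "{x}"] \<open>B = {}\<close> show False by blast
  qed
  ultimately show thesis using B(1) by (intro that) (auto dest: meets)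
qed

theorem theorem7p8:
  fixes p :: "'a::semilattice_sup"
  assumes "subfit_semilattice TYPE('a)"
    and "round_semilattice TYPE('a)"
  shows "compactin spectrum_topology (spectrum_topology closure_of (spectrum_at p))"
proof -
  define K where "K = {G \<in> spectrum. \<forall>F. far (F \<union> {p}) \<longrightarrow> \<not> F \<subseteq> G}"
  obtain q where q: "rather_below p q"
    using assms(2) unfolding round_semilattice_def by blast
  have K_far: "\<not> F \<subseteq> G" if "G \<in> K" "far (F \<union> {p})" for F G
    using that by (auto simp: K_def)
  have K_spec: "G \<in> spectrum" if "G \<in> K" for G
    using that by (simp add: K_def)
  have Kq: "q \<in> G" if "G \<in> K" for G
    using rather_below_closure[OF q K_spec K_far] that by blast
  have "compactin spectrum_topology K"
    unfolding spectrum_topology_def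
  proof (rule compactin_topology_generated_by)
    show "K \<subseteq> \<Union>(range spectrum_at)"
      using Kq K_spec by (auto simp: spectrum_at_def)
  next
    fix C assume "C \<subseteq> range spectrum_at" and cover: "K \<subseteq> \<Union>C"
    then obtain A where A: "C = spectrum_at ` A" by (meson subset_imageE)
    show "\<exists>C'. finite C' \<and> C' \<subseteq> C \<and> K \<subseteq> \<Union>C'"
    proof (rule ccontr)
      assume neg: "\<not> ?thesis"
      have "\<exists>G\<in>K. F \<inter> G = {}" if "finite F" "F \<subseteq> A" for F
      proof -
        have "\<not> K \<subseteq> \<Union>(spectrum_at ` F)"
          using neg that A by (metis finite_imageI image_mono)
        then show ?thesis
          using K_spec by (fastforce simp: spectrum_at_def)
      qed
      moreover have "ideal (- G) \<and> - G \<noteq> {}" if "G \<in> K" for G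
        using spectrum_ideal[OF K_spec[OF that]] by blast
      ultimately obtain B where B: "A \<subseteq> B" "ideal B" "B \<noteq> {}"
        and miss: "\<And>x. x \<in> B \<Longrightarrow> \<exists>G\<in>K. x \<notin> G"
        and meets: "\<And>F. finite F \<Longrightarrow> (\<And>G. G \<in> K \<Longrightarrow> \<not> F \<subseteq> G) \<Longrightarrow> F \<inter> B \<noteq> {}"
        using maximal_finitely_missed[of K A] by metis
      have far: "F \<inter> B \<noteq> {}" if "far (F \<union> {p})" for F
      proof (rule meets)
        show "finite F" using that by (simp add: far_def)
      qed (use K_far that in blast)
      \<comment> \<open>Each element of \<open>B\<close> is missed by some grill in
        \<open>K\<close>, whereas \<open>q\<close> lies in all of them.\<close>
      have "q \<notin> B" using miss Kq by blast
      then obtain G where G: "G \<in> spectrum" "G \<inter> B = {}"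
        using spectrum_above_ideal[OF q B(2,3)] far by blast
      \<comment> \<open>A set far together with \<open>p\<close> has an element in \<open>B\<close>,
        which lies outside \<open>G\<close>.\<close>
      then have "G \<in> K" using far by (fastforce simp: K_def)
      with cover obtain a where "a \<in> A" "a \<in> G"
        unfolding A by (auto simp: spectrum_at_def)
      with B(1) G(2) show False by blast
    qed
  qed
  then show ?thesis
    unfolding K_def closure_of_spectrum_at[OF assms] .
qed

end
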